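(* Let $n\ge1$ and let $F_1=F_2=1$, $F_m=F_{m-1}+F_{m-2}$ be the Fibonacci numbers. For any fixed transposition $\tau$ of $\{i,j,k\}$ (i.e. any fixed one of the three main axes), $$|A_n(\tau)|=3\cdot4^{n-1}-2^n,$$ $$|A_n(\tau)\cap L_n|=3^n-2^n,$$ $$|A_n(\tau)\cap X_n|=3\cdot4^{n-1}-3^n,$$ $$|A_n(\tau)\cap L_n\cap P_n|=F_{2n+2}-2^n .$$ Counting each triangle only once when it is symmetric about more than one axis, $$|A_n|=9\cdot4^{n-1}-5\cdot2^n+2,$$ $$|A_n\cap L_n|=3^{n+1}-5\cdot2^n+2,$$ $$|A_n\cap X_n|=9\cdot4^{n-1}-3^{n+1},$$ $$|A_n\cap L_n\cap P_n|=3F_{2n+2}-5\cdot2^n+2 .$$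
   Context: $\Delta_n=\{i,j,k,e\}^n$ is the set of words $b=b_1b_2\cdots b_n$ of length $n$ in the four symbols $i,j,k,e$. Put $v(i)=(\cos 210^\circ,\sin 210^\circ)$, $v(j)=(\cos 90^\circ,\sin 90^\circ)$, $v(k)=(\cos 330^\circ,\sin 330^\circ)$, $v(e)=(0,0)$ in $\mathbb R^2$. Fix a real $d_1>0$ and put $d_r=d_1/2^{r-1}$. The centroid map $P:\Delta_n\to\mathbb R^2$ is $$P(b)=\sum_{r=1}^n \sigma_r(b)\,d_r\,v(b_r),\qquad \sigma_r(b)=(-1)^{\#\{s<r:\ b_s=e\}}.$$ $E_n$ is the set of unordered triples $\{b_1,b_2,b_3\}$ of distinct words in $\Delta_n$ such that $P(b_1),P(b_2),P(b_3)$ are the vertices of a nondegenerate equilateral triangle. For $b\in\Delta_n$ put $\mathrm{supp}(b)=\{r: b_r\ne e\}$. Let $\gamma$ be the permutation $i\mapsto j\mapsto k\mapsto i$, $e\mapsto e$. For nonempty $S\subseteq\mathrm{supp}(b)$, $\gamma_S(b)$ is obtained by applying $\gamma$ in the coordinates of $S$ and fixing the others, and $T(b,S)=\{b,\gamma_S(b),\gamma_S^2(b)\}$, which is always an element of $E_n$. The local class is $L_n=\{T(b,S): b\in\Delta_n,\ \varnothing\ne S\subseteq\mathrm{supp}(b)\}\subseteq E_n$, and the nonlocal class is $X_n=E_n\setminus L_n$. Words are multiplied coordinatewise as quaternions ($e$ the identity, $i^2=j^2=k^2=-e$, $ij=k$, $jk=i$, $ki=j$, distinct elements of $\{i,j,k\}$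 anticommute), with local signs collected into one global sign, giving an element of $\{\pm b:b\in\Delta_n\}$; let $u(\pm b)=b$ for $b\in\Delta_n$. Any two words commute or anticommute, so for $T=\{b_1,b_2,b_3\}\in E_n$ the word $p(T)=u(b_1b_2b_3)$ is well defined. Put $C_T=P(p(T))$, $Q_T=\frac13(P(b_1)+P(b_2)+P(b_3))$, and $P_n=\{T\in E_n: C_T=Q_T\}$ (product-centered triangles). A transposition $\tau$ of $\{i,j,k\}$ (with $\tau(e)=e$) acts on words digitwise, which under $P$ corresponds to reflection in one of the three main axes (the line through the origin spanned by $v(f_\tau)$, $f_\tau$ being the noncentral digit fixed by $\tau$). $A_n(\tau)=\{T\in E_n:\tau(T)=T\}$ (invariance as a set of words), and $A_n$ is the union of the sets $A_n(\tau)$ over the three transpositions $\tau$. *)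

theory Defs
  imports
    "HOL-Analysis.Analysis"
    "HOL-Combinatorics.Transposition"
    "HOL-Number_Theory.Fib"
begin

(* Words are lists; positions are 0-based, so the r-th letter in the usual 1-based
   numbering is b ! (r - 1). *)

datatype digit = QI | QJ | QK | QE

type_synonym word = "digit list"

definition Delta :: "nat \<Rightarrow> word set" where
  "Delta n = {b. length b = n}"

(* The angles are 210, 90 and 330 degrees. *)
fun dir :: "digit \<Rightarrow> real \<times> real" where
  "dir QI = (cos (7 * pi / 6), sin (7 * pi / 6))"
| "dir QJ = (cos (pi / 2), sin (pi / 2))"
| "dir QK = (cos (11 * pi / 6), sin (11 * pi / 6))"
| "dir QE = (0, 0)"

definition sigma :: "nat \<Rightarrow> word \<Rightarrow> real" where
  "sigma r b = (- 1) ^ card {s. s < r \<and> b ! s = QE}"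

(* With 0-based positions the scale d_1 / 2^(r-1) becomes d / 2^r, where d = d_1. *)
definition centroid_map :: "real \<Rightarrow> word \<Rightarrow> real \<times> real" where
  "centroid_map d b = (\<Sum>r<length b. (sigma r b * (d / 2 ^ r)) *\<^sub>R dir (b ! r))"

definition nondeg_equilateral :: "'a::metric_space \<Rightarrow> 'a \<Rightarrow> 'a \<Rightarrow> bool" where
  "nondeg_equilateral x y z \<longleftrightarrow> dist x y = dist y z \<and> dist y z = dist z x \<and> dist x y > 0"

definition equi_triangles :: "real \<Rightarrow> nat \<Rightarrow> word set set" where
  "equi_triangles d n =
    {{b1, b2, b3} | b1 b2 b3.
       b1 \<in> Delta n \<and> b2 \<in> Delta n \<and> b3 \<in> Delta n \<and>
       b1 \<noteq> b2 \<and> b2 \<noteq> b3 \<and> b1 \<noteq> b3 \<and>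
       nondeg_equilateral (centroid_map d b1) (centroid_map d b2) (centroid_map d b3)}"

definition supp :: "word \<Rightarrow> nat set" where
  "supp b = {r. r < length b \<and> b ! r \<noteq> QE}"

fun cyc :: "digit \<Rightarrow> digit" where
  "cyc QI = QJ" | "cyc QJ = QK" | "cyc QK = QI" | "cyc QE = QE"

definition cyc_on :: "nat set \<Rightarrow> word \<Rightarrow> word" where
  "cyc_on S b = map (\<lambda>r. if r \<in> S then cyc (b ! r) else b ! r) [0..<length b]"

definition local_triple :: "word \<Rightarrow> nat set \<Rightarrow> word set" where
  "local_triple b S = {b, cyc_on S b, cyc_on S (cyc_on S b)}"

definition local_class :: "nat \<Rightarrow> word set set" where
  "local_class n = {local_triple b S | b S. b \<in> Delta n \<and> S \<noteq> {} \<and> S \<subseteq> supp b}"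

definition nonlocal_class :: "real \<Rightarrow> nat \<Rightarrow> word set set" where
  "nonlocal_class d n = equi_triangles d n - local_class n"

fun dmult :: "digit \<Rightarrow> digit \<Rightarrow> int \<times> digit" where
  "dmult QE y = (1, y)"
| "dmult x QE = (1, x)"
| "dmult QI QI = (- 1, QE)"
| "dmult QJ QJ = (- 1, QE)"
| "dmult QK QK = (- 1, QE)"
| "dmult QI QJ = (1, QK)"
| "dmult QJ QK = (1, QI)"
| "dmult QK QI = (1, QJ)"
| "dmult QJ QI = (- 1, QK)"
| "dmult QK QJ = (- 1, QI)"
| "dmult QI QK = (- 1, QJ)"

(* A pair (s, b) with s = 1 or s = -1 stands for the signed word s b. *)
type_synonym signed_word = "int \<times> word"

definition wmult :: "signed_word \<Rightarrow> signed_word \<Rightarrow> signed_word" where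
  "wmult x y =
    (fst x * fst y * prod_list (map2 (\<lambda>a b. fst (dmult a b)) (snd x) (snd y)),
     map2 (\<lambda>a b. snd (dmult a b)) (snd x) (snd y))"

definition unsign :: "signed_word \<Rightarrow> word" where
  "unsign x = snd x"

definition triple_product :: "word \<Rightarrow> word \<Rightarrow> word \<Rightarrow> word" where
  "triple_product b1 b2 b3 = unsign (wmult (wmult (1, b1) (1, b2)) (1, b3))"

definition product_word :: "word set \<Rightarrow> word" where
  "product_word T =
    (THE w. \<exists>b1 b2 b3. T = {b1, b2, b3} \<and> b1 \<noteq> b2 \<and> b2 \<noteq> b3 \<and> b1 \<noteq> b3 \<and>
       w = triple_product b1 b2 b3)"

lemma snd_dmult_commute: "snd (dmult x y) = snd (dmult y x)"
  by (cases x; cases y) simp_all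

lemma snd_dmult_right_commute:
  "snd (dmult (snd (dmult x y)) z) = snd (dmult (snd (dmult x z)) y)"
  by (cases x; cases y; cases z) simp_all

lemma triple_product_swap12: "triple_product b1 b2 b3 = triple_product b2 b1 b3"
proof -
  have "map2 (\<lambda>a b. snd (dmult a b)) b1 b2 = map2 (\<lambda>a b. snd (dmult a b)) b2 b1"
    by (rule nth_equalityI) (auto simp: snd_dmult_commute)
  then show ?thesis
    by (simp add: triple_product_def unsign_def wmult_def)
qed

lemma triple_product_swap23: "triple_product b1 b2 b3 = triple_product b1 b3 b2"
  unfolding triple_product_def unsign_def wmult_def
  by (rule nth_equalityI) (auto simp: snd_dmult_right_commute)

lemma product_word_eq:
  assumes "b1 \<noteq> b2" "b2 \<noteq> b3" "b1 \<noteq> b3"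
  shows "product_word {b1, b2, b3} = triple_product b1 b2 b3"
  unfolding product_word_def
proof (rule the_equality)
  show "\<exists>c1 c2 c3. {b1, b2, b3} = {c1, c2, c3} \<and> c1 \<noteq> c2 \<and> c2 \<noteq> c3 \<and> c1 \<noteq> c3 \<and>
      triple_product b1 b2 b3 = triple_product c1 c2 c3"
    using assms by blast
next
  fix w
  assume "\<exists>c1 c2 c3. {b1, b2, b3} = {c1, c2, c3} \<and> c1 \<noteq> c2 \<and> c2 \<noteq> c3 \<and> c1 \<noteq> c3 \<and>
      w = triple_product c1 c2 c3"
  then obtain c1 c2 c3 where c: "{b1, b2, b3} = {c1, c2, c3}"
      "c1 \<noteq> c2" "c2 \<noteq> c3" "c1 \<noteq> c3" and w: "w = triple_product c1 c2 c3"
    by blast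
  have "(c1 = b1 \<and> c2 = b2 \<and> c3 = b3) \<or> (c1 = b1 \<and> c2 = b3 \<and> c3 = b2) \<or>
        (c1 = b2 \<and> c2 = b1 \<and> c3 = b3) \<or> (c1 = b2 \<and> c2 = b3 \<and> c3 = b1) \<or>
        (c1 = b3 \<and> c2 = b1 \<and> c3 = b2) \<or> (c1 = b3 \<and> c2 = b2 \<and> c3 = b1)"
  proof -
    have "c1 \<in> {b1, b2, b3}" "c2 \<in> {b1, b2, b3}" "c3 \<in> {b1, b2, b3}"
      using c(1) by auto
    then show ?thesis
      using c(2-4) by auto
  qed
  then show "w = triple_product b1 b2 b3"
    using w by (metis triple_product_swap12 triple_product_swap23)
qed

definition product_centered :: "real \<Rightarrow> nat \<Rightarrow> word set set" where
  "product_centered d n =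
    {T \<in> equi_triangles d n.
       centroid_map d (product_word T) = (1 / 3) *\<^sub>R (\<Sum>b\<in>T. centroid_map d b)}"

definition digit_transpositions :: "(digit \<Rightarrow> digit) set" where
  "digit_transpositions =
    {Transposition.transpose QI QJ, Transposition.transpose QJ QK,
     Transposition.transpose QI QK}"

definition axis_triangles :: "real \<Rightarrow> nat \<Rightarrow> (digit \<Rightarrow> digit) \<Rightarrow> word set set" where
  "axis_triangles d n \<tau> = {T \<in> equi_triangles d n. map \<tau> ` T = T}"

definition all_axis_triangles :: "real \<Rightarrow> nat \<Rightarrow> word set set" where
  "all_axis_triangles d n = (\<Union>\<tau>\<in>digit_transpositions. axis_triangles d n \<tau>)"

end

theory Submission
  imports Defs
begin

text \<open>
  Write a word's centroid as \<open>P(b) = (2 d / 2\<^sup>n) (F v(f) + H v(h) + G v(g))\<close> with integer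
  amplitudes \<open>F, H, G\<close>, where \<open>f\<close> is the noncentral digit fixed by the transposition \<open>\<tau>\<close>,
  \<open>h = \<gamma>(f)\<close> and \<open>g = \<gamma>(h)\<close>. Squared distances are one symmetric quadratic form in the
  differences of the amplitudes, so the whole count is integer arithmetic and the three axes
  are treated at once.

  A \<open>\<tau>\<close>-invariant triangle has exactly one \<open>\<tau>\<close>-fixed vertex \<open>a\<close>, a word over \<open>{f, e}\<close> whose
  point lies on the axis, and two vertices \<open>b\<close>, \<open>\<tau> b\<close> exchanged by \<open>\<tau>\<close>; three fixed vertices
  would be collinear. For a given base \<open>b\<close>, \<open>\<tau> b\<close> the triangle is equilateral exactly when the
  amplitude of \<open>a\<close> is \<open>F + H - 2 G\<close> or \<open>F + G - 2 H\<close> (lemma \<open>gap_mirror_iff\<close>); exchanging \<open>b\<close>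
  and \<open>\<tau> b\<close> reduces the second case to the first. Now \<open>F + H - 2 G\<close> is the amplitude of a word
  over \<open>{f, e}\<close> if and only if \<open>b\<close> does not begin with \<open>g\<close>: the negative contribution of a later
  \<open>g\<close> can be carried into the letter in front of it (lemma \<open>amp_apex_aux\<close>), while a leading
  \<open>g\<close> makes the value too negative (lemma \<open>no_apex\<close>). As amplitudes determine words over
  \<open>{f, e}\<close>, the triangles invariant under \<open>\<tau>\<close> correspond bijectively to the words \<open>b\<close> that do not
  begin with \<open>g\<close> and contain \<open>g\<close> or \<open>h\<close>, which gives \<open>3 \<cdot> 4\<^bsup>n-1\<^esup> - 2\<^sup>n\<close>.

  In this parametrization a triangle is local exactly when \<open>g\<close> does not occur in \<open>b\<close>
  (lemma \<open>tri_local_iff\<close>), which leaves the \<open>3\<^sup>n - 2\<^sup>n\<close> words over \<open>{f, h, e}\<close> containing \<open>h\<close>.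
  The product word of such a triangle is \<open>b\<close> with every \<open>h\<close> replaced by \<open>e\<close>, and the triangle is
  product-centered exactly when this replacement does not change the amplitude \<open>F\<close>, because the
  multiples of \<open>v(h)\<close> and \<open>v(g)\<close> in the barycenter cancel. A leading \<open>h\<close> exchanges the conditions
  that the amplitude is kept and that it is negated, and this two-state recursion yields the
  Fibonacci numbers (lemma \<open>card_centered_words\<close>).

  Finally, a triangle invariant under two of the transpositions is an orbit
  \<open>{a, \<gamma> a, \<gamma>\<^sup>2 a}\<close> of a word \<open>a \<noteq> e\<dots>e\<close> over two letters \<open>x, e\<close>. There are \<open>2\<^sup>n - 1\<close> of these
  orbits; each is invariant under all three transpositions, local and product-centered.
  Inclusion-exclusion then subtracts \<open>2 (2\<^sup>n - 1)\<close> from three times the count for a single axis,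
  and the nonlocal counts are differences.
\<close>

section \<open>Digits and the axis reflections\<close>

text \<open>
  Each transposition is indexed by the digit \<open>f\<close> that it fixes. Naming the other two digits
  \<open>cyc f\<close> and \<open>cyc (cyc f)\<close> lets one argument serve all three axes.
\<close>

definition mirror :: "digit \<Rightarrow> digit \<Rightarrow> digit" where
  "mirror f = Transposition.transpose (cyc f) (cyc (cyc f))"

lemma digit_transpositions_eq: "digit_transpositions = mirror ` {QI, QJ, QK}"
  by (auto simp: digit_transpositions_def mirror_def transpose_commute)

lemma cyc_simps [simp]:
  "cyc (cyc (cyc x)) = x" "cyc x = QE \<longleftrightarrow> x = QE" "QE = cyc x \<longleftrightarrow> x = QE"
  "cyc x = cyc y \<longleftrightarrow> x = y"
  by (cases x; cases y; simp)+

lemma cyc_neq: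
  assumes "f \<noteq> QE"
  shows "cyc f \<noteq> f" "cyc (cyc f) \<noteq> f" "f \<noteq> cyc f" "f \<noteq> cyc (cyc f)"
    "cyc (cyc f) \<noteq> cyc f" "cyc f \<noteq> cyc (cyc f)"
  using assms by (cases f; simp)+

lemma digit_cases:
  assumes "f \<noteq> QE"
  obtains "x = f" | "x = cyc f" | "x = cyc (cyc f)" | "x = QE"
  using assms by (cases f; cases x) auto

lemma mirror_simps:
  assumes "f \<noteq> QE"
  shows "mirror f f = f" "mirror f (cyc f) = cyc (cyc f)" "mirror f (cyc (cyc f)) = cyc f"
    "mirror f QE = QE"
  using assms by (auto simp: mirror_def transpose_def cyc_neq)

lemma mirror_mirror [simp]: "mirror f (mirror f x) = x"
  by (simp add: mirror_def)

lemma map_mirror_mirror [simp]: "map (mirror f) (map (mirror f) b) = b"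
  by (simp add: o_def)

lemma map_mirror_fixed_iff:
  assumes "f \<noteq> QE"
  shows "map (mirror f) b = b \<longleftrightarrow> set b \<subseteq> {f, QE}"
proof -
  have "mirror f x = x \<longleftrightarrow> x \<in> {f, QE}" for x
    using assms by (cases x rule: digit_cases[OF assms]) (auto simp: mirror_simps cyc_neq)
  then show ?thesis
    using map_eq_conv[of "mirror f" b "\<lambda>x. x"] by auto
qed

lemma axis_word_iff:
  assumes "f \<noteq> QE"
  shows "set b \<subseteq> {f, QE} \<longleftrightarrow> cyc f \<notin> set b \<and> cyc (cyc f) \<notin> set b"
proof -
  have "x \<in> {f, QE} \<longleftrightarrow> x \<noteq> cyc f \<and> x \<noteq> cyc (cyc f)" for x
    using assms by (cases x rule: digit_cases[OF assms]) (auto simp: cyc_neq)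
  then show ?thesis by blast
qed

section \<open>Integer amplitudes and distances\<close>

text \<open>
  The coefficient of \<open>dir x\<close> in the centroid, in units of the smallest scale. Removing the first
  letter leaves the scales of the remaining letters unchanged in these units, and a leading
  central digit flips all later signs.
\<close>

fun amp :: "digit \<Rightarrow> word \<Rightarrow> int" where
  "amp x [] = 0"
| "amp x (y # b) = (if y = x then 2 ^ length b else 0) + (if y = QE then - amp x b else amp x b)"

lemma sigma_Cons_Suc: "sigma (Suc r) (x # b) = (if x = QE then - 1 else 1) * sigma r b"
proof -
  have "{s. s < Suc r \<and> (x # b) ! s = QE} =
      (if x = QE then {0} else {}) \<union> Suc ` {s. s < r \<and> b ! s = QE}"
    (is "?A = ?B")
  proof (rule set_eqI)
    show "s \<in> ?A \<longleftrightarrow> s \<in> ?B" for s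
      by (cases s) auto
  qed
  moreover have "card (Suc ` {s. s < r \<and> b ! s = QE}) = card {s. s < r \<and> b ! s = QE}"
    by (simp add: card_image)
  ultimately show ?thesis
    by (simp add: sigma_def)
qed

lemma centroid_map_Cons:
  "centroid_map d (x # b) =
     d *\<^sub>R dir x + ((if x = QE then - 1 else 1) / 2) *\<^sub>R centroid_map d b"
proof -
  have "sigma 0 (x # b) = 1" by (simp add: sigma_def)
  then show ?thesis
    by (simp add: centroid_map_def sum.lessThan_Suc_shift sigma_Cons_Suc scaleR_sum_right
        mult_ac del: sum.lessThan_Suc)
qed

lemma centroid_map_amp:
  assumes "f \<noteq> QE"
  shows "centroid_map d b = (2 * d / 2 ^ length b) *\<^sub>R
    (of_int (amp f b) *\<^sub>R dir f + of_int (amp (cyc f) b) *\<^sub>R dir (cyc f)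
      + of_int (amp (cyc (cyc f)) b) *\<^sub>R dir (cyc (cyc f)))"
proof (induction b)
  case Nil
  then show ?case by (simp add: centroid_map_def)
next
  case (Cons x b)
  let ?k = "2 * d / 2 ^ length (x # b)"
  let ?s = "if x = QE then - 1 else 1 :: int"
  have step: "amp y (x # b) = (if x = y then 2 ^ length b else 0) + ?s * amp y b" for y
    by simp
  have half: "((if x = QE then - 1 else 1) / 2) * (2 * d / 2 ^ length b) = ?k * of_int ?s"
    by simp
  have head: "d *\<^sub>R dir x = ?k *\<^sub>R
     (of_int (if x = f then 2 ^ length b else 0) *\<^sub>R dir f
      + of_int (if x = cyc f then 2 ^ length b else 0) *\<^sub>R dir (cyc f)
      + of_int (if x = cyc (cyc f) then 2 ^ length b else 0) *\<^sub>R dir (cyc (cyc f)))"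
    using assms
    by (cases x rule: digit_cases[OF assms]) (simp_all add: cyc_neq zero_prod_def[symmetric])
  show ?case
    unfolding centroid_map_Cons Cons.IH scaleR_scaleR half head step
    by (simp only: of_int_add of_int_mult scaleR_add_left scaleR_add_right scaleR_scaleR
        mult.assoc add_ac)
qed

lemma dir_values:
  "dir QI = (- sqrt 3 / 2, - 1 / 2)" "dir QJ = (0, 1)" "dir QK = (sqrt 3 / 2, - 1 / 2)"
proof -
  have "7 * pi / 6 = pi / 6 + pi" "11 * pi / 6 = - (pi / 6) + 2 * pi" by simp_all
  then show "dir QI = (- sqrt 3 / 2, - 1 / 2)" "dir QK = (sqrt 3 / 2, - 1 / 2)"
    unfolding dir.simps
    by (simp_all only: cos_periodic sin_periodic cos_periodic_pi sin_periodic_pi cos_minus sin_minus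
        cos_30 sin_30) simp_all
qed simp

lemma dir_sum: "f \<noteq> QE \<Longrightarrow> dir f + dir (cyc f) + dir (cyc (cyc f)) = 0"
  by (cases f) (simp_all add: dir_values zero_prod_def del: dir.simps)

text \<open>
  The squared distance of two centroids up to a common factor: the vectors \<open>dir QI\<close>, \<open>dir QJ\<close>,
  \<open>dir QK\<close> have norm \<open>1\<close> and pairwise inner product \<open>-1/2\<close>.
\<close>

definition gap :: "word \<Rightarrow> word \<Rightarrow> int" where
  "gap b c = (let x = amp QI b - amp QI c; y = amp QJ b - amp QJ c; z = amp QK b - amp QK c
    in x\<^sup>2 + y\<^sup>2 + z\<^sup>2 - x * y - y * z - z * x)"

lemma gap_alt:
  assumes "f \<noteq> QE"
  shows "gap b c = (let x = amp f b - amp f c; y = amp (cyc f) b - amp (cyc f) c;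
      z = amp (cyc (cyc f)) b - amp (cyc (cyc f)) c
    in x\<^sup>2 + y\<^sup>2 + z\<^sup>2 - x * y - y * z - z * x)"
  using assms by (cases f) (simp_all add: gap_def Let_def algebra_simps)

lemma norm_dir_combination:
  "norm (x *\<^sub>R dir QI + y *\<^sub>R dir QJ + z *\<^sub>R dir QK)
    = sqrt (x\<^sup>2 + y\<^sup>2 + z\<^sup>2 - x * y - y * z - z * x)"
proof -
  have s: "sqrt 3 * sqrt 3 = (3::real)" by simp
  have "(z * sqrt 3 / 2 - x * sqrt 3 / 2)\<^sup>2 = 3 / 4 * (z - x)\<^sup>2"
    by (simp add: power2_eq_square field_simps s)
  then show ?thesis
    unfolding dir_values
    by (simp add: norm_Pair) (simp add: power2_eq_square field_simps)
qed

lemma dist_centroid_map: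
  assumes "d > 0" "length b = length c"
  shows "dist (centroid_map d b) (centroid_map d c)
    = (2 * d / 2 ^ length c) * sqrt (of_int (gap b c))"
proof -
  have "centroid_map d b - centroid_map d c = (2 * d / 2 ^ length c) *\<^sub>R
     (of_int (amp QI b - amp QI c) *\<^sub>R dir QI + of_int (amp QJ b - amp QJ c) *\<^sub>R dir QJ
       + of_int (amp QK b - amp QK c) *\<^sub>R dir QK)"
    unfolding centroid_map_amp[of QI, unfolded cyc.simps, OF digit.distinct(5)] assms(2)
      scaleR_diff_right[symmetric] of_int_diff scaleR_diff_left
    by (simp add: algebra_simps del: dir.simps)
  then show ?thesis
    using assms(1) unfolding dist_norm
    by (simp only: norm_scaleR norm_dir_combination) (simp add: gap_def Let_def)
qed

lemma nondeg_equilateral_iff_gap: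
  assumes "d > 0" "length a = n" "length b = n" "length c = n"
  shows "nondeg_equilateral (centroid_map d a) (centroid_map d b) (centroid_map d c)
    \<longleftrightarrow> gap a b = gap b c \<and> gap b c = gap c a \<and> gap a b > 0"
proof -
  have "2 * d / 2 ^ n > 0" using assms by simp
  then show ?thesis
    using assms by (simp add: nondeg_equilateral_def dist_centroid_map zero_less_mult_iff zero_less_divide_iff)
qed

text \<open>
  The three side conditions are symmetric, so they may be tested on any listing of the vertices.
\<close>

lemma equi_triangles_insert_iff:
  assumes "d > 0"
  shows "{a, b, c} \<in> equi_triangles d n \<longleftrightarrow>
    a \<in> Delta n \<and> b \<in> Delta n \<and> c \<in> Delta n \<and>
    gap a b = gap b c \<and> gap b c = gap c a \<and> gap a b > 0" (is "?L \<longleftrightarrow> ?R")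
proof
  have sym: "gap x y = gap y x" for x y
    by (simp add: gap_def Let_def power2_eq_square algebra_simps)
  assume ?L
  then obtain a' b' c' where eq: "{a, b, c} = {a', b', c'}"
    and D: "a' \<in> Delta n" "b' \<in> Delta n" "c' \<in> Delta n" "a' \<noteq> b'" "b' \<noteq> c'" "a' \<noteq> c'"
    and E: "nondeg_equilateral (centroid_map d a') (centroid_map d b') (centroid_map d c')"
    by (auto simp: equi_triangles_def)
  have G: "gap a' b' = gap b' c'" "gap b' c' = gap c' a'" "gap a' b' > 0"
    using E nondeg_equilateral_iff_gap[OF assms, of a' n b' c'] D by (auto simp: Delta_def)
  have "a \<in> {a', b', c'}" "b \<in> {a', b', c'}" "c \<in> {a', b', c'}"
    "a' \<in> {a, b, c}" "b' \<in> {a, b, c}" "c' \<in> {a, b, c}"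
    using eq by blast+
  then show ?R
    using D G sym[of a' b'] sym[of b' c'] sym[of c' a'] by auto
next
  assume R: ?R
  have "gap x x = 0" for x by (simp add: gap_def)
  then have "a \<noteq> b" "b \<noteq> c" "a \<noteq> c" using R by force+
  then show ?L
    using R nondeg_equilateral_iff_gap[OF assms, of a n b c]
    unfolding equi_triangles_def Delta_def by blast
qed

section \<open>Leading terms\<close>

text \<open>
  The difference of two amplitudes is a sum of the powers \<open>1, 2, \<dots>, 2\<^bsup>n-1\<^esup>\<close> with coefficients
  in \<open>{-1, 0, 1}\<close>, so a nonzero leading term cannot be cancelled by the rest.
\<close>

lemma amp_diff_bound:
  assumes "x \<noteq> QE" "y \<noteq> QE"
  shows "\<bar>amp x b - amp y b\<bar> < 2 ^ length b"
  using assms by (induction b) (auto)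

lemma amp_diff_zero_iff:
  assumes "x \<noteq> QE" "y \<noteq> QE" "x \<noteq> y"
  shows "amp x b = amp y b \<longleftrightarrow> x \<notin> set b \<and> y \<notin> set b"
proof (induction b)
  case (Cons z b)
  show ?case
    using Cons assms amp_diff_bound[OF assms(1,2), of b] by auto
qed simp

lemma amp_bound: "x \<noteq> QE \<Longrightarrow> \<bar>amp x b\<bar> < 2 ^ length b"
  by (induction b) auto

lemma amp_zero_iff: "x \<noteq> QE \<Longrightarrow> amp x b = 0 \<longleftrightarrow> x \<notin> set b"
proof (induction b)
  case (Cons z b)
  then show ?case
    using amp_bound[of x b] by auto
qed simp

lemma amp_map_mirror:
  assumes "f \<noteq> QE"
  shows "amp f (map (mirror f) b) = amp f b"
    "amp (cyc f) (map (mirror f) b) = amp (cyc (cyc f)) b"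
    "amp (cyc (cyc f)) (map (mirror f) b) = amp (cyc f) b"
proof (induction b)
  case (Cons x b)
  {
    case 1
    show ?case using assms Cons
      by (cases x rule: digit_cases[OF assms]) (simp_all add: mirror_simps cyc_neq)
  }
  {
    case 2
    show ?case using assms Cons
      by (cases x rule: digit_cases[OF assms]) (simp_all add: mirror_simps cyc_neq)
  }
  {
    case 3
    show ?case using assms Cons
      by (cases x rule: digit_cases[OF assms]) (simp_all add: mirror_simps cyc_neq)
  }
qed simp_all

section \<open>The apex over a symmetric base\<close>

text \<open>
  Two lines through the centroid of \<open>b\<close> make an angle of 30 degrees with the axis of \<open>f\<close>. They meet
  the axis where the apex of an equilateral triangle on \<open>b\<close> and its mirror image has to be. In units
  of the smallest scale, the coefficients of \<open>dir f\<close> at these points are the slants of \<open>b\<close> and of its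
  mirror image.
\<close>

definition slant :: "digit \<Rightarrow> word \<Rightarrow> int" where
  "slant f b = amp f b + amp (cyc f) b - 2 * amp (cyc (cyc f)) b"

lemma slant_bounds:
  assumes "f \<noteq> QE"
  shows "- 2 * 2 ^ length b + 2 \<le> slant f b \<and> slant f b < 2 ^ length b"
proof (induction b)
  case (Cons x b)
  then show ?case
    using assms by (cases x rule: digit_cases[OF assms]) (auto simp: slant_def cyc_neq)
qed (simp add: slant_def)

text \<open>
  Only a leading central digit can make the amplitude negative, so the lower half of the negative
  range allowed by \<open>amp_bound\<close> is missing. This separates words with different first letters
  in \<open>axis_amp_inj\<close> and excludes a leading \<open>cyc (cyc f)\<close> in \<open>no_apex\<close>.
\<close>

lemma axis_amp_lower_bound:
  assumes "f \<noteq> QE" "set a \<subseteq> {f, QE}"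
  shows "- (2 ^ length a) < 2 * amp f a"
  using assms(2)
proof (induction a)
  case (Cons x a)
  then show ?case
    using assms(1) amp_bound[OF assms(1), of a] by auto
qed simp

lemma axis_amp_inj:
  assumes "f \<noteq> QE" "set a \<subseteq> {f, QE}" "set b \<subseteq> {f, QE}" "length a = length b" "amp f a = amp f b"
  shows "a = b"
  using assms(4,2,3,5)
proof (induction a b rule: list_induct2)
  case (Cons x a y b)
  have "- (2 ^ length a) < 2 * amp f a" "- (2 ^ length b) < 2 * amp f b"
    using axis_amp_lower_bound assms(1) Cons.prems by auto
  then have "x = y" "amp f a = amp f b"
    using Cons.prems Cons.hyps assms(1) by (auto split: if_splits)
  then show ?case using Cons by auto
qed simp

text \<open>
  The base has squared length \<open>3 (G - H)\<^sup>2\<close>, and the equation saying that a leg is as long as the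
  base factors into the two linear equations on the right.
\<close>

lemma gap_mirror_iff:
  assumes "f \<noteq> QE" "set a \<subseteq> {f, QE}"
  shows "gap a b = gap b (map (mirror f) b) \<and> gap b (map (mirror f) b) = gap (map (mirror f) b) a
      \<and> gap a b > 0 \<longleftrightarrow>
    map (mirror f) b \<noteq> b \<and> (amp f a = slant f b \<or> amp f a = slant f (map (mirror f) b))"
    (is "?L \<longleftrightarrow> ?R")
proof -
  let ?F = "amp f b" and ?H = "amp (cyc f) b" and ?G = "amp (cyc (cyc f)) b" and ?A = "amp f a"
  have z: "amp (cyc f) a = 0" "amp (cyc (cyc f)) a = 0"
    using assms by (subst amp_zero_iff; auto simp: cyc_neq)+
  have 1: "gap b (map (mirror f) b) = 3 * (?G - ?H)\<^sup>2"
    unfolding gap_alt[OF assms(1)] amp_map_mirror[OF assms(1)] Let_def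
    by (simp add: power2_eq_square algebra_simps)
  have 2: "gap a b = (?A - ?F)\<^sup>2 + (?A - ?F) * (?G + ?H) + ?G\<^sup>2 + ?H\<^sup>2 - ?G * ?H"
    unfolding gap_alt[OF assms(1)] z Let_def
    by (simp add: power2_eq_square algebra_simps)
  have 3: "gap (map (mirror f) b) a = gap a b"
    unfolding 2 unfolding gap_alt[OF assms(1)] amp_map_mirror[OF assms(1)] z Let_def
    by (simp add: power2_eq_square algebra_simps)
  have 4: "gap a b - 3 * (?G - ?H)\<^sup>2 = (?A - ?F + 2 * ?G - ?H) * (?A - ?F - ?G + 2 * ?H)"
    unfolding 2 by (simp add: power2_eq_square algebra_simps)
  have 5: "?A = slant f b \<longleftrightarrow> ?A - ?F + 2 * ?G - ?H = 0"
    "?A = slant f (map (mirror f) b) \<longleftrightarrow> ?A - ?F - ?G + 2 * ?H = 0"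
    by (auto simp: slant_def amp_map_mirror[OF assms(1)])
  have 6: "map (mirror f) b \<noteq> b \<longleftrightarrow> ?G \<noteq> ?H"
    using amp_diff_zero_iff[of "cyc (cyc f)" "cyc f" b] assms(1)
    unfolding map_mirror_fixed_iff[OF assms(1)] axis_word_iff[OF assms(1)]
    by (auto simp: cyc_neq)
  have "?L \<longleftrightarrow> gap a b = 3 * (?G - ?H)\<^sup>2 \<and> ?G \<noteq> ?H"
    unfolding 3 1 by auto
  also have "\<dots> \<longleftrightarrow> ?R"
    unfolding 5 6 using 4 by (metis eq_iff_diff_eq_0 mult_eq_0_iff)
  finally show ?thesis .
qed

text \<open>
  With \<open>h = cyc f\<close> and \<open>g = cyc h\<close>, the letters \<open>f\<close>, \<open>h\<close>, \<open>g\<close> contribute to the slant with weights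
  \<open>1, 1, -2\<close>. Hence \<open>h\<close> may be replaced by \<open>f\<close>, and the weight \<open>-2\<close> of a letter \<open>g\<close> is a carry into the
  next larger scale: \<open>fg\<close> may be replaced by \<open>ee\<close> and \<open>eg\<close> by \<open>fe\<close>, with the same sign in front of
  all later letters. So every \<open>g\<close> becomes \<open>e\<close>, and every letter followed by a \<open>g\<close> is
  exchanged between \<open>f\<close> and \<open>e\<close>.
\<close>

fun apex :: "digit \<Rightarrow> word \<Rightarrow> word" where
  "apex f [] = []"
| "apex f (x # b) =
    (if (x = QE \<or> x = cyc (cyc f)) = (b \<noteq> [] \<and> hd b = cyc (cyc f)) then f else QE) # apex f b"

lemma length_apex [simp]: "length (apex f b) = length b"
  by (induction b) auto

lemma set_apex: "set (apex f b) \<subseteq> {f, QE}"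
  by (induction b) auto

text \<open>
  The carry out of a leading \<open>cyc (cyc f)\<close> is lost, which amounts to reading that letter as the
  central digit; the general form is what the induction needs.
\<close>

lemma amp_apex_aux:
  assumes "f \<noteq> QE"
  shows "amp f (apex f b) =
    slant f (if b \<noteq> [] \<and> hd b = cyc (cyc f) then QE # tl b else b)"
proof (induction b)
  case (Cons x b)
  show ?case
  proof (cases b)
    case Nil
    then show ?thesis using assms
      by (cases x rule: digit_cases[OF assms]) (auto simp: slant_def cyc_neq)
  next
    case (Cons y c)
    then show ?thesis using assms Cons.IH
      by (cases x rule: digit_cases[OF assms]; cases y rule: digit_cases[OF assms])
       (auto simp: slant_def cyc_neq)
  qed
qed (simp add: slant_def)

lemma amp_apex:
  assumes "f \<noteq> QE" "hd b \<noteq> cyc (cyc f)"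
  shows "amp f (apex f b) = slant f b"
  using assms by (simp add: amp_apex_aux)

text \<open>
  A leading \<open>cyc (cyc f)\<close> pushes the slant below \<open>-2\<^sup>m\<close>, and amplitudes of words of length
  \<open>m + 1\<close> on the axis stay above this bound.
\<close>

lemma no_apex:
  assumes "f \<noteq> QE" "set a \<subseteq> {f, QE}" "length a = Suc m" "length b = Suc m" "hd b = cyc (cyc f)"
  shows "amp f a \<noteq> slant f b"
proof -
  obtain c where b: "b = cyc (cyc f) # c" "length c = m"
    using assms(4,5) by (cases b) auto
  have "slant f b = slant f c - 2 * 2 ^ m"
    using assms(1) by (simp add: b slant_def cyc_neq)
  with slant_bounds[OF assms(1), of c] axis_amp_lower_bound[OF assms(1,2)] show ?thesis
    using b assms(3) by auto
qed


section \<open>Axis triangles and their base words\<close>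

lemma involution_triple:
  assumes inv: "\<And>x. t (t x) = x" and T: "t ` {x, y, z} = {x, y, z}"
    and ne: "x \<noteq> y" "y \<noteq> z" "x \<noteq> z"
  shows "t x = x \<and> t y = y \<and> t z = z \<or> (\<exists>a b. {x, y, z} = {a, b, t b} \<and> t a = a \<and> t b \<noteq> b)"
proof -
  have inj: "t u = t v \<Longrightarrow> u = v" for u v using inv by metis
  have "t x = x \<or> t x = y \<or> t x = z" "t y = x \<or> t y = y \<or> t y = z" "t z = x \<or> t z = y \<or> t z = z"
    using T by auto
  then consider "t x = x" "t y = y" "t z = z" | "t x = x" "t y = z" | "t y = y" "t x = z"
    | "t z = z" "t x = y"
    using ne inj inv by metis
  then show ?thesis
  proof cases
    case 2 then show ?thesis using ne by (intro disjI2 exI[of _ x] exI[of _ y]) auto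
  next
    case 3 then show ?thesis using ne by (intro disjI2 exI[of _ y] exI[of _ x]) auto
  next
    case 4 then show ?thesis using ne by (intro disjI2 exI[of _ z] exI[of _ x]) auto
  qed simp
qed

definition tri :: "digit \<Rightarrow> word \<Rightarrow> word set" where
  "tri f b = {apex f b, b, map (mirror f) b}"

text \<open>
  The words whose slant is attained on the axis, without those on the axis itself. If a word and
  its mirror image are both in the set, they have the same base but belong to different triangles,
  on opposite sides of the base. In an invariant triangle only one of the two exchanged vertices
  has the slant of the apex. The length is meant to be positive.
\<close>

definition base_words :: "digit \<Rightarrow> nat \<Rightarrow> word set" where
  "base_words f n = {b. length b = n \<and> hd b \<noteq> cyc (cyc f) \<and> \<not> set b \<subseteq> {f, QE}}"

lemma tri_distinct:
  assumes "f \<noteq> QE" "b \<in> base_words f n"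
  shows "b \<noteq> map (mirror f) b" "apex f b \<noteq> b" "apex f b \<noteq> map (mirror f) b"
proof -
  have "\<not> set b \<subseteq> {f, QE}" using assms(2) by (simp add: base_words_def)
  then show "b \<noteq> map (mirror f) b" "apex f b \<noteq> b" "apex f b \<noteq> map (mirror f) b"
    using set_apex[of f b] map_mirror_fixed_iff[OF assms(1), of b]
      map_mirror_fixed_iff[OF assms(1), of "apex f b"] map_mirror_mirror[of f b]
    by metis+
qed

lemma not_equilateral_on_axis:
  assumes "f \<noteq> QE" "set a \<subseteq> {f, QE}" "set b \<subseteq> {f, QE}" "set c \<subseteq> {f, QE}"
  shows "\<not> (gap a b = gap b c \<and> gap b c = gap c a \<and> gap a b > 0)"
proof
  assume G: "gap a b = gap b c \<and> gap b c = gap c a \<and> gap a b > 0"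
  have "gap x y = (amp f x - amp f y)\<^sup>2" if "set x \<subseteq> {f, QE}" "set y \<subseteq> {f, QE}" for x y
  proof -
    have "amp (cyc f) x = 0" "amp (cyc (cyc f)) x = 0" "amp (cyc f) y = 0" "amp (cyc (cyc f)) y = 0"
      using that assms(1) by (simp_all add: amp_zero_iff axis_word_iff)
    then show ?thesis by (simp add: gap_alt[OF assms(1)])
  qed
  then have "(amp f a - amp f b)\<^sup>2 = (amp f b - amp f c)\<^sup>2"
    "(amp f b - amp f c)\<^sup>2 = (amp f c - amp f a)\<^sup>2" "(amp f a - amp f b)\<^sup>2 > 0"
    using G assms by auto
  then show False
    unfolding power2_eq_iff by auto
qed

lemma axis_triangles_eq:
  assumes "d > 0" "f \<noteq> QE" "n \<ge> 1"
  shows "axis_triangles d n (mirror f) = tri f ` base_words f n"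
proof (rule set_eqI, rule iffI)
  fix T assume "T \<in> axis_triangles d n (mirror f)"
  then have E: "T \<in> equi_triangles d n" and inv: "map (mirror f) ` T = T"
    by (auto simp: axis_triangles_def)
  obtain x y z where T: "T = {x, y, z}" and ne: "x \<noteq> y" "y \<noteq> z" "x \<noteq> z"
    using E by (auto simp: equi_triangles_def)
  have "\<not> (map (mirror f) x = x \<and> map (mirror f) y = y \<and> map (mirror f) z = z)"
    using E not_equilateral_on_axis[OF assms(2), of x y z]
    unfolding T equi_triangles_insert_iff[OF assms(1)] map_mirror_fixed_iff[OF assms(2)] by blast
  then obtain a b where Tab: "T = {a, b, map (mirror f) b}" and a: "set a \<subseteq> {f, QE}"
    and b: "\<not> set b \<subseteq> {f, QE}"
    using involution_triple[of "map (mirror f)", OF map_mirror_mirror inv[unfolded T] ne]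
    unfolding T map_mirror_fixed_iff[OF assms(2)] by blast
  have D: "a \<in> Delta n" "b \<in> Delta n" "map (mirror f) b \<in> Delta n"
    and "amp f a = slant f b \<or> amp f a = slant f (map (mirror f) b)"
    using E gap_mirror_iff[OF assms(2) a, of b]
    unfolding Tab equi_triangles_insert_iff[OF assms(1)] by blast+
  moreover have "\<not> set (map (mirror f) b) \<subseteq> {f, QE}"
    using b by (metis map_mirror_fixed_iff[OF assms(2)] map_mirror_mirror)
  moreover have "T = {a, map (mirror f) b, map (mirror f) (map (mirror f) b)}"
    unfolding map_mirror_mirror Tab by blast
  \<comment> \<open>\<open>c\<close> is the one of the two exchanged vertices whose slant is the amplitude of the apex.\<close>
  ultimately obtain c where c: "T = {a, c, map (mirror f) c}" "\<not> set c \<subseteq> {f, QE}"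
    "amp f a = slant f c" "c \<in> Delta n"
    using Tab b D by blast
  have hd: "hd c \<noteq> cyc (cyc f)"
    using no_apex[OF assms(2) a, of "n - 1" c] c D assms(3) by (auto simp: Delta_def)
  have "a = apex f c"
    using axis_amp_inj[OF assms(2) a set_apex, of c] amp_apex[OF assms(2) hd] c D
    by (simp add: Delta_def)
  then show "T \<in> tri f ` base_words f n"
    using c hd by (auto simp: tri_def base_words_def Delta_def)
next
  fix T assume "T \<in> tri f ` base_words f n"
  then obtain b where T: "T = {apex f b, b, map (mirror f) b}" and b: "length b = n"
    "hd b \<noteq> cyc (cyc f)" "\<not> set b \<subseteq> {f, QE}"
    by (auto simp: tri_def base_words_def)
  have "T \<in> equi_triangles d n"
    using b gap_mirror_iff[OF assms(2) set_apex, of b b] amp_apex[OF assms(2) b(2)]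
    unfolding T equi_triangles_insert_iff[OF assms(1)] map_mirror_fixed_iff[OF assms(2)]
    by (simp add: Delta_def)
  moreover have "map (mirror f) (apex f b) = apex f b"
    using set_apex map_mirror_fixed_iff[OF assms(2)] by blast
  then have "map (mirror f) ` T = T"
    unfolding T image_insert image_empty map_mirror_mirror by auto
  ultimately show "T \<in> axis_triangles d n (mirror f)"
    by (simp add: axis_triangles_def)
qed

text \<open>
  The apex is the only fixed vertex, so it can be read off the triangle. The two other vertices
  have different slants, and only one of the slants is the amplitude of the apex.
\<close>

lemma inj_on_tri:
  assumes "f \<noteq> QE"
  shows "inj_on (tri f) (base_words f n)"
proof (rule inj_onI)
  fix b c assume bc: "b \<in> base_words f n" "c \<in> base_words f n" and eq: "tri f b = tri f c"
  let ?t = "map (mirror f)"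
  have fix_apex: "{x \<in> tri f x'. ?t x = x} = {apex f x'}" if "x' \<in> base_words f n" for x'
  proof -
    have "?t (apex f x') = apex f x'" "?t x' \<noteq> x'"
      using set_apex that by (auto simp: map_mirror_fixed_iff[OF assms] base_words_def)
    then show ?thesis by (auto simp: tri_def simp del: map_map)
  qed
  have apex: "apex f b = apex f c"
    using fix_apex[OF bc(1)] fix_apex[OF bc(2)] eq by auto
  have "slant f b = slant f c"
    using apex amp_apex[OF assms, of b] amp_apex[OF assms, of c] bc by (simp add: base_words_def)
  moreover have "slant f (?t c) \<noteq> slant f c"
    using amp_diff_zero_iff[of "cyc f" "cyc (cyc f)" c] bc(2) assms
    by (auto simp: slant_def amp_map_mirror[OF assms] base_words_def axis_word_iff cyc_neq)
  ultimately have "b \<noteq> ?t c" by auto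
  moreover have "b \<in> tri f c" "b \<noteq> apex f c"
    using eq bc set_apex[of f c] by (auto simp: tri_def base_words_def)
  ultimately show "b = c" by (auto simp: tri_def)
qed

section \<open>Local triangles\<close>

definition collapse :: "digit \<Rightarrow> word \<Rightarrow> word" where
  "collapse f = map (\<lambda>x. if x = QE then QE else f)"

lemma amp_collapse:
  assumes "f \<noteq> QE"
  shows "amp f (collapse f b) = amp f b + amp (cyc f) b + amp (cyc (cyc f)) b"
proof (induction b)
  case (Cons x b)
  then show ?case
    using assms by (cases x rule: digit_cases[OF assms]) (auto simp: collapse_def cyc_neq)
qed (simp add: collapse_def)

text \<open>
  Collapsing has amplitude \<open>F + H + G\<close> and the apex has amplitude \<open>F + H - 2 G\<close>, so the two words
  agree exactly when \<open>G = 0\<close>.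
\<close>

lemma apex_eq_collapse_iff:
  assumes "f \<noteq> QE" "hd b \<noteq> cyc (cyc f)"
  shows "apex f b = collapse f b \<longleftrightarrow> cyc (cyc f) \<notin> set b"
proof -
  have "set (collapse f b) \<subseteq> {f, QE}" by (auto simp: collapse_def)
  then have "apex f b = collapse f b \<longleftrightarrow> slant f b = amp f (collapse f b)"
    using axis_amp_inj[OF assms(1) set_apex, of "collapse f b" b] amp_apex[OF assms]
    by (auto simp: collapse_def)
  also have "\<dots> \<longleftrightarrow> amp (cyc (cyc f)) b = 0"
    unfolding amp_collapse[OF assms(1)] slant_def by auto
  finally show ?thesis using assms(1) by (simp add: amp_zero_iff)
qed

lemma length_cyc_on [simp]: "length (cyc_on S b) = length b"
  by (simp add: cyc_on_def)

lemma nth_cyc_on: "r < length b \<Longrightarrow> cyc_on S b ! r = (if r \<in> S then cyc (b ! r) else b ! r)"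
  by (simp add: cyc_on_def)

lemma collapse_cyc_on: "collapse f (cyc_on S b) = collapse f b"
  by (rule nth_equalityI) (auto simp: collapse_def nth_cyc_on)

text \<open>
  All words of a local triple have central digits at the same positions. So in a local triangle
  the apex is the collapse of the base word. Conversely, the base word arises from its collapse by
  rotating the positions where it has the letter \<open>cyc f\<close>.
\<close>

lemma tri_local_iff:
  assumes "f \<noteq> QE" "b \<in> base_words f n"
  shows "tri f b \<in> local_class n \<longleftrightarrow> cyc (cyc f) \<notin> set b"
proof -
  have b: "hd b \<noteq> cyc (cyc f)" "length b = n" "\<not> set b \<subseteq> {f, QE}"
    using assms(2) by (auto simp: base_words_def)
  show ?thesis
  proof
    assume "tri f b \<in> local_class n"
    then obtain c S where "tri f b = local_triple c S"
      by (auto simp: local_class_def)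
    then have "collapse f x = collapse f c" if "x \<in> tri f b" for x
      using that by (auto simp: local_triple_def collapse_cyc_on)
    then have "collapse f (apex f b) = collapse f b"
      by (auto simp: tri_def)
    moreover have "collapse f (apex f b) = apex f b"
      unfolding collapse_def using set_apex[of f b] by (intro map_idI) auto
    ultimately show "cyc (cyc f) \<notin> set b"
      using apex_eq_collapse_iff[OF assms(1) b(1)] by simp
  next
    assume g: "cyc (cyc f) \<notin> set b"
    define S where "S = {r. r < length b \<and> b ! r = cyc f}"
    have apex: "apex f b = collapse f b"
      using apex_eq_collapse_iff[OF assms(1) b(1)] g by simp
    have 1: "cyc_on S (apex f b) = b"
    proof (rule nth_equalityI)
      fix r assume "r < length (cyc_on S (apex f b))"
      then have r: "r < length b" by simp
      then have "b ! r \<noteq> cyc (cyc f)" using g by (metis nth_mem)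
      then show "cyc_on S (apex f b) ! r = b ! r"
        using r assms(1)
        by (cases "b ! r" rule: digit_cases[OF assms(1)])
          (auto simp: nth_cyc_on apex collapse_def S_def cyc_neq)
    qed simp
    have 2: "cyc_on S b = map (mirror f) b"
    proof (rule nth_equalityI)
      fix r assume "r < length (cyc_on S b)"
      then have r: "r < length b" by simp
      then have "b ! r \<noteq> cyc (cyc f)" using g by (metis nth_mem)
      then show "cyc_on S b ! r = map (mirror f) b ! r"
        using r assms(1)
        by (cases "b ! r" rule: digit_cases[OF assms(1)])
          (auto simp: nth_cyc_on mirror_simps S_def cyc_neq)
    qed simp
    have "tri f b = local_triple (apex f b) S"
      by (simp add: tri_def local_triple_def 1 2)
    moreover have "S \<noteq> {}"
      using b(3) g axis_word_iff[OF assms(1), of b] by (auto simp: S_def in_set_conv_nth)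
    moreover have "S \<subseteq> supp (apex f b)"
      using assms(1) by (auto simp: supp_def S_def apex collapse_def)
    ultimately show "tri f b \<in> local_class n"
      using b(2) unfolding local_class_def Delta_def by (auto intro!: exI[of _ "apex f b"] exI[of _ S])
  qed
qed

section \<open>Product-centered local triangles\<close>

definition strip :: "digit \<Rightarrow> word \<Rightarrow> word" where
  "strip f = map (\<lambda>x. if x = cyc f then QE else x)"

text \<open>
  Where the base word has the letter \<open>cyc f\<close>, the three vertices carry three different noncentral
  digits, with product \<open>\<plusminus>e\<close>; elsewhere they agree, and \<open>x x x = \<plusminus>x\<close>.
\<close>

lemma product_word_tri:
  assumes "f \<noteq> QE" "b \<in> base_words f n" "cyc (cyc f) \<notin> set b"
  shows "product_word (tri f b) = strip f b"
proof -
  have b: "hd b \<noteq> cyc (cyc f)" "\<not> set b \<subseteq> {f, QE}"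
    using assms(2) by (auto simp: base_words_def)
  have apex: "apex f b = collapse f b"
    using apex_eq_collapse_iff[OF assms(1) b(1)] assms(3) by simp
  note ne = tri_distinct[OF assms(1,2)]
  have "triple_product (apex f b) b (map (mirror f) b) = strip f b"
  proof (rule nth_equalityI)
    fix r assume "r < length (triple_product (apex f b) b (map (mirror f) b))"
    then have r: "r < length b" by (simp add: triple_product_def unsign_def wmult_def)
    then have "b ! r \<noteq> cyc (cyc f)" using assms(3) by (metis nth_mem)
    moreover have "apex f b ! r = (if b ! r = QE then QE else f)"
      using r by (simp add: apex collapse_def)
    ultimately show "triple_product (apex f b) b (map (mirror f) b) ! r = strip f b ! r"
      using r assms(1)
      by (cases "b ! r" rule: digit_cases[OF assms(1)]; cases f)
        (auto simp: triple_product_def unsign_def wmult_def strip_def mirror_def transpose_def)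
  qed (simp add: triple_product_def unsign_def wmult_def strip_def)
  then show ?thesis
    using product_word_eq[OF ne(2,1,3)] by (simp add: tri_def)
qed

text \<open>
  The vertices have coordinate vectors \<open>(F + H, 0, 0)\<close>, \<open>(F, H, 0)\<close> and \<open>(F, 0, H)\<close> with respect
  to \<open>dir f\<close>, \<open>dir (cyc f)\<close>, \<open>dir (cyc (cyc f))\<close>. As these directions add up to zero, the barycenter is
  \<open>F dir f\<close>.
\<close>

lemma tri_product_centered_iff:
  assumes "d > 0" "f \<noteq> QE" "b \<in> base_words f n" "n \<ge> 1" "cyc (cyc f) \<notin> set b"
  shows "tri f b \<in> product_centered d n \<longleftrightarrow> amp f (strip f b) = amp f b"
proof -
  have b: "hd b \<noteq> cyc (cyc f)" "length b = n" "\<not> set b \<subseteq> {f, QE}"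
    using assms(3) by (auto simp: base_words_def)
  let ?t = "map (mirror f)"
  let ?k = "2 * d / 2 ^ n" and ?F = "real_of_int (amp f b)" and ?H = "real_of_int (amp (cyc f) b)"
  note ne = tri_distinct[OF assms(2,3)]
  have "tri f b \<in> axis_triangles d n (mirror f)"
    using axis_triangles_eq[OF assms(1,2,4)] assms(3) by auto
  then have E: "tri f b \<in> equi_triangles d n" by (simp add: axis_triangles_def)
  have G: "amp (cyc (cyc f)) b = 0" using assms(2,5) by (simp add: amp_zero_iff)
  have on_axis: "centroid_map d a = (?k * of_int (amp f a)) *\<^sub>R dir f"
    if "set a \<subseteq> {f, QE}" "length a = n" for a
  proof -
    have "amp (cyc f) a = 0" "amp (cyc (cyc f)) a = 0"
      using that(1) assms(2) by (simp_all add: amp_zero_iff axis_word_iff)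
    then show ?thesis
      using that(2) by (simp add: centroid_map_amp[OF assms(2)])
  qed
  have "set (strip f b) \<subseteq> {f, QE}"
    unfolding axis_word_iff[OF assms(2)] using assms(2,5)
    by (auto simp: strip_def cyc_neq)
  then have C: "centroid_map d (product_word (tri f b)) = (?k * of_int (amp f (strip f b))) *\<^sub>R dir f"
    using on_axis[of "strip f b"] product_word_tri[OF assms(2,3,5)] b(2) by (simp add: strip_def)
  have apexC: "centroid_map d (apex f b) = ?k *\<^sub>R ((?F + ?H) *\<^sub>R dir f)"
    using on_axis[OF set_apex, of b] b(2) amp_apex[OF assms(2) b(1)] G by (simp add: slant_def)
  have bC: "centroid_map d b = ?k *\<^sub>R (?F *\<^sub>R dir f + ?H *\<^sub>R dir (cyc f))"
    "centroid_map d (?t b) = ?k *\<^sub>R (?F *\<^sub>R dir f + ?H *\<^sub>R dir (cyc (cyc f)))"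
    unfolding centroid_map_amp[OF assms(2)] amp_map_mirror[OF assms(2)] G using b(2) by simp_all
  have "(\<Sum>x\<in>tri f b. centroid_map d x) =
      ?k *\<^sub>R ((3 * ?F) *\<^sub>R dir f + ?H *\<^sub>R (dir f + dir (cyc f) + dir (cyc (cyc f))))"
  proof -
    have three: "(3 * ?F) *\<^sub>R dir f = ?F *\<^sub>R dir f + ?F *\<^sub>R dir f + ?F *\<^sub>R dir f"
      by (simp only: scaleR_left_distrib[symmetric]) simp
    have "(\<Sum>x\<in>tri f b. centroid_map d x) =
        centroid_map d (apex f b) + (centroid_map d b + centroid_map d (?t b))"
      using ne by (simp add: tri_def)
    then show ?thesis
      unfolding apexC bC three
      by (simp only: scaleR_left_distrib scaleR_add_right add_ac)
  qed
  then have Q: "(1 / 3) *\<^sub>R (\<Sum>x\<in>tri f b. centroid_map d x) = (?k * ?F) *\<^sub>R dir f"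
    by (simp add: dir_sum[OF assms(2)])
  have "dir f \<noteq> 0"
    using assms(2) by (cases f) (simp_all add: dir_values zero_prod_def del: dir.simps)
  then show ?thesis
    using E assms(1) unfolding product_centered_def C mem_Collect_eq Q by simp
qed

text \<open>
  The case \<open>s = 1\<close> is the condition for product-centered triangles. The case \<open>s = -1\<close> arises from it
  by removing a leading \<open>cyc f\<close>, whose replacement by the central digit flips all later signs.
\<close>

definition centered_words :: "digit \<Rightarrow> int \<Rightarrow> nat \<Rightarrow> word set" where
  "centered_words f s n =
     {b. length b = n \<and> set b \<subseteq> {f, cyc f, QE} \<and> amp f (strip f b) = s * amp f b}"

text \<open>
  If the amplitude is kept, the word may begin with any of the three letters, and \<open>cyc f\<close> leads to the
  negated state. If it is negated, the first letter cannot be \<open>f\<close>, since its power of two would have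
  to be cancelled by the rest; the central digit keeps the state and \<open>cyc f\<close> returns to the first one.
  This is \<open>E' = 2 E + O\<close> and \<open>O' = E + O\<close>, two steps of the Fibonacci recursion.
\<close>

lemma card_centered_words:
  assumes "f \<noteq> QE"
  shows "card (centered_words f 1 n) = fib (2 * n + 2) \<and>
    card (centered_words f (- 1) n) = fib (2 * n + 1)"
proof (induction n)
  case 0
  have "centered_words f s 0 = {[]}" for s
    by (auto simp: centered_words_def strip_def)
  then show ?case by simp
next
  case (Suc n)
  let ?W = "centered_words f"
  have fin: "finite (?W s m)" for s m
    by (rule finite_subset[OF _ finite_lists_length_eq[of "{f, cyc f, QE}" m]])
      (auto simp: centered_words_def)
  have bound: "2 * 2 ^ length b + amp f (strip f b) + amp f b \<noteq> 0" for b
    using amp_bound[OF assms, of b] amp_bound[OF assms, of "strip f b"] by (auto simp: strip_def)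
  have even: "?W 1 (Suc n) = (#) f ` ?W 1 n \<union> ((#) QE ` ?W 1 n \<union> (#) (cyc f) ` ?W (- 1) n)" (is "_ = ?R")
  proof (rule set_eqI)
    show "b \<in> ?W 1 (Suc n) \<longleftrightarrow> b \<in> ?R" for b
      using assms by (cases b) (auto simp: centered_words_def strip_def cyc_neq)
  qed
  have odd: "?W (- 1) (Suc n) = (#) QE ` ?W (- 1) n \<union> (#) (cyc f) ` ?W 1 n" (is "_ = ?R")
  proof (rule set_eqI)
    show "b \<in> ?W (- 1) (Suc n) \<longleftrightarrow> b \<in> ?R" for b
      using assms bound[of "tl b"] by (cases b) (auto simp: centered_words_def strip_def cyc_neq)
  qed
  have "card (?W 1 (Suc n)) = card (?W 1 n) + (card (?W 1 n) + card (?W (- 1) n))"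
    unfolding even using assms
    by (subst card_Un_disjoint; (subst card_Un_disjoint)?) (auto simp: fin card_image cyc_neq)
  moreover have "card (?W (- 1) (Suc n)) = card (?W (- 1) n) + card (?W 1 n)"
    unfolding odd using assms by (subst card_Un_disjoint) (auto simp: fin card_image)
  ultimately show ?case using Suc by (simp add: numeral_eq_Suc)
qed


section \<open>Counting base words\<close>

lemma finite_digits: "finite (A :: digit set)"
proof (rule finite_subset)
  show "A \<subseteq> {QI, QJ, QK, QE}" using digit.exhaust by blast
qed simp

lemma finite_words: "finite {b :: word. length b = n \<and> P b}"
  by (rule finite_subset[OF _ finite_lists_length_eq[OF finite_digits[of UNIV], of n]]) auto

lemma finite_base_words: "finite (base_words f n)"
  unfolding base_words_def by (rule finite_words)

lemma card_axis_letters: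
  assumes "f \<noteq> QE"
  shows "card {f, cyc f, QE} = 3" "card {f, QE} = 2"
  using assms by (auto simp: cyc_neq)

lemma card_base_words:
  assumes "f \<noteq> QE" "n \<ge> 1"
  shows "int (card (base_words f n)) = 3 * 4 ^ (n - 1) - 2 ^ n"
proof -
  obtain m where n: "n = Suc m" using assms(2) by (cases n) auto
  have UNIV: "(UNIV :: digit set) = {f, cyc f, cyc (cyc f), QE}"
    using digit_cases[OF assms(1)] by blast
  let ?V = "\<lambda>A k. {b :: word. set b \<subseteq> A \<and> length b = k}"
  let ?A = "(\<lambda>(x, b). x # b) ` ({f, cyc f, QE} \<times> ?V UNIV m)"
  have fin: "finite (?V A k)" for A k
    by (rule finite_subset[OF _ finite_words[of k "\<lambda>_. True"]]) auto
  have "card (UNIV :: digit set) = 4" unfolding UNIV using assms(1) by (auto simp: cyc_neq)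
  then have "card (?V UNIV m) = 4 ^ m"
    using card_lists_length_eq[of UNIV m] UNIV by (metis finite.emptyI finite.insertI)
  moreover have "card ?A = card ({f, cyc f, QE} \<times> ?V UNIV m)"
    by (rule card_image) (auto simp: inj_on_def)
  ultimately have cA: "card ?A = 3 * 4 ^ m"
    by (simp only: card_cartesian_product card_axis_letters[OF assms(1)])
  have base: "base_words f n = ?A - ?V {f, QE} n"
  proof (rule set_eqI)
    show "b \<in> base_words f n \<longleftrightarrow> b \<in> ?A - ?V {f, QE} n" for b
    proof (cases b)
      case (Cons x c)
      then show ?thesis using assms(1)
        by (cases x rule: digit_cases[OF assms(1)]) (auto simp: base_words_def n image_iff cyc_neq)
    qed (auto simp: base_words_def n)
  qed
  have sub: "?V {f, QE} n \<subseteq> ?A"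
  proof
    fix b assume "b \<in> ?V {f, QE} n"
    then show "b \<in> ?A" by (cases b) (auto simp: n image_iff)
  qed
  have cV: "card (?V {f, QE} n) = 2 ^ n"
    using card_lists_length_eq[of "{f, QE}" n] card_axis_letters[OF assms(1)] by simp
  have "finite ?A"
    by (intro finite_imageI finite_cartesian_product fin) simp
  then have "card (?V {f, QE} n) \<le> card ?A"
    by (rule card_mono[OF _ sub])
  then have "2 ^ n \<le> (3 * 4 ^ m :: nat)"
    by (simp only: cV cA)
  moreover have "card (base_words f n) = 3 * 4 ^ m - 2 ^ n"
    unfolding base card_Diff_subset[OF fin sub] cA cV ..
  ultimately show ?thesis by (simp add: n of_nat_diff)
qed

lemma local_base_words_eq:
  assumes "f \<noteq> QE" "n \<ge> 1"
  shows "{b \<in> base_words f n. cyc (cyc f) \<notin> set b} =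
    {b. set b \<subseteq> {f, cyc f, QE} \<and> length b = n} - {b. set b \<subseteq> {f, QE} \<and> length b = n}"
proof -
  have iff: "cyc (cyc f) \<notin> set b \<longleftrightarrow> set b \<subseteq> {f, cyc f, QE}" for b
  proof -
    have "x \<noteq> cyc (cyc f) \<longleftrightarrow> x \<in> {f, cyc f, QE}" for x
      using assms(1) by (cases x rule: digit_cases[OF assms(1)]) (auto simp: cyc_neq)
    then show ?thesis by blast
  qed
  have hd: "hd b \<noteq> cyc (cyc f)" if "length b = n" "cyc (cyc f) \<notin> set b" for b
    using that assms(2) hd_in_set[of b] by (cases b) auto
  show ?thesis
    using hd by (auto simp: base_words_def simp flip: iff)
qed

lemma card_local_base_words:
  assumes "f \<noteq> QE" "n \<ge> 1"
  shows "int (card {b \<in> base_words f n. cyc (cyc f) \<notin> set b}) = 3 ^ n - 2 ^ n"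
proof -
  have "card {b. set b \<subseteq> {f, cyc f, QE} \<and> length b = n} = 3 ^ n"
    "card {b. set b \<subseteq> {f, QE} \<and> length b = n} = 2 ^ n"
    using card_lists_length_eq[of "{f, cyc f, QE}" n] card_lists_length_eq[of "{f, QE}" n] card_axis_letters[OF assms(1)]
    by simp_all
  moreover have "finite {b. set b \<subseteq> {f, QE} \<and> length b = n}"
    by (rule finite_lists_length_eq) simp
  ultimately show ?thesis
    unfolding local_base_words_eq[OF assms]
    by (subst card_Diff_subset) (auto simp: of_nat_diff power_mono)
qed

lemma card_centered_base_words:
  assumes "f \<noteq> QE" "n \<ge> 1"
  shows "int (card {b \<in> base_words f n. cyc (cyc f) \<notin> set b \<and> amp f (strip f b) = amp f b})
    = int (fib (2 * n + 2)) - 2 ^ n"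
proof -
  let ?V = "{b. set b \<subseteq> {f, QE} \<and> length b = n}"
  have "{b \<in> base_words f n. cyc (cyc f) \<notin> set b \<and> amp f (strip f b) = amp f b}
      = {b \<in> base_words f n. cyc (cyc f) \<notin> set b} \<inter> {b. amp f (strip f b) = amp f b}"
    by auto
  also have "\<dots> = centered_words f 1 n - ?V"
    unfolding local_base_words_eq[OF assms] by (auto simp: centered_words_def)
  finally have eq: "{b \<in> base_words f n. cyc (cyc f) \<notin> set b \<and> amp f (strip f b) = amp f b}
      = centered_words f 1 n - ?V" .
  have "strip f b = b" if "b \<in> ?V" for b
    using that assms(1) unfolding strip_def by (intro map_idI) (auto simp: cyc_neq)
  then have sub: "?V \<subseteq> centered_words f 1 n"
    by (auto simp: centered_words_def)
  have fin: "finite (centered_words f 1 n)"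
    unfolding centered_words_def by (rule finite_words)
  have "card ?V = 2 ^ n"
    using card_lists_length_eq[of "{f, QE}" n] card_axis_letters[OF assms(1)] by simp
  moreover have "card ?V \<le> card (centered_words f 1 n)"
    by (rule card_mono[OF fin sub])
  ultimately show ?thesis
    unfolding eq card_Diff_subset[OF finite_subset[OF sub fin] sub]
    using card_centered_words[OF assms(1), of n] by (simp add: of_nat_diff)
qed

section \<open>Triangles with several symmetry axes\<close>

text \<open>
  Letting the digit \<open>x\<close> vary keeps the definition independent of an axis; the three choices of \<open>x\<close>
  list every orbit three times.
\<close>

definition rotation_orbits :: "nat \<Rightarrow> word set set" where
  "rotation_orbits n = {{a, map cyc a, map cyc (map cyc a)} | a x.
     x \<noteq> QE \<and> length a = n \<and> set a \<subseteq> {x, QE} \<and> x \<in> set a}"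

lemma map_cyc3 [simp]: "map cyc (map cyc (map cyc a)) = a"
  by (simp add: o_def)

lemma tri_eq_orbit:
  assumes "f \<noteq> QE" "set b \<subseteq> {cyc f, QE}"
  shows "tri f b = {b, map cyc b, map cyc (map cyc b)}"
proof -
  have "cyc (cyc f) \<notin> set b" using assms by (auto simp: cyc_neq)
  moreover have "hd b \<noteq> cyc (cyc f)" if "b \<noteq> []" using calculation that hd_in_set by metis
  ultimately have "apex f b = collapse f b"
    using apex_eq_collapse_iff[OF assms(1), of b] by (cases "b = []") (auto simp: collapse_def)
  moreover have "collapse f b = map cyc (map cyc b)" "map (mirror f) b = map cyc b"
    using assms by (auto simp: collapse_def mirror_simps)
  ultimately show ?thesis by (auto simp: tri_def simp del: map_map)
qed

text \<open>
  Each orbit has exactly one vertex over the letters \<open>cyc f\<close> and \<open>QE\<close>, and it serves as base word.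
\<close>

lemma rotation_orbits_eq:
  assumes "f \<noteq> QE" "n \<ge> 1"
  shows "rotation_orbits n = tri f ` {b. length b = n \<and> set b \<subseteq> {cyc f, QE} \<and> cyc f \<in> set b}"
    (is "_ = tri f ` ?B")
proof (rule set_eqI, rule iffI)
  fix T assume "T \<in> rotation_orbits n"
  then obtain a x where T: "T = {a, map cyc a, map cyc (map cyc a)}" and x: "x \<noteq> QE"
    and a: "length a = n" "set a \<subseteq> {x, QE}" "x \<in> set a"
    by (auto simp: rotation_orbits_def)
  have "\<exists>b \<in> {a, map cyc a, map cyc (map cyc a)}. b \<in> ?B"
  proof -
    have rot: "set (map cyc c) \<subseteq> {cyc y, QE} \<and> cyc y \<in> set (map cyc c)"
      if "set c \<subseteq> {y, QE} \<and> y \<in> set c" for c y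
      using that by auto
    have "set (map cyc a) \<subseteq> {cyc x, QE} \<and> cyc x \<in> set (map cyc a)"
      using rot a by blast
    then have "set (map cyc (map cyc a)) \<subseteq> {cyc (cyc x), QE} \<and> cyc (cyc x) \<in> set (map cyc (map cyc a))"
      by (rule rot)
    with \<open>set (map cyc a) \<subseteq> {cyc x, QE} \<and> cyc x \<in> set (map cyc a)\<close> show ?thesis
      using a x by (cases x rule: digit_cases[OF assms(1)]) (simp_all del: map_map set_map)
  qed
  then obtain b where b: "b \<in> {a, map cyc a, map cyc (map cyc a)}" "b \<in> ?B" by blast
  then have "T = {b, map cyc b, map cyc (map cyc b)}"
    unfolding T using map_cyc3[of a] by (auto simp del: map_map map_cyc3)
  then show "T \<in> tri f ` ?B"
    using tri_eq_orbit[OF assms(1), of b] b(2) by auto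
next
  fix T assume "T \<in> tri f ` ?B"
  then show "T \<in> rotation_orbits n"
    using tri_eq_orbit[OF assms(1)] assms(1) unfolding rotation_orbits_def
    by (auto intro!: exI[of _ "cyc f"] simp del: map_map)
qed

lemma orbit_base_words:
  assumes "f \<noteq> QE" "n \<ge> 1" "b \<in> {b. length b = n \<and> set b \<subseteq> {cyc f, QE} \<and> cyc f \<in> set b}"
  shows "b \<in> base_words f n" "cyc (cyc f) \<notin> set b" "amp f (strip f b) = amp f b"
proof -
  show g: "cyc (cyc f) \<notin> set b"
    using assms by (auto simp: cyc_neq)
  have "b \<noteq> []" using assms by auto
  then have "hd b \<noteq> cyc (cyc f)" using g hd_in_set by metis
  then show "b \<in> base_words f n"
    using assms by (auto simp: base_words_def cyc_neq)
  have "f \<notin> set b" "f \<notin> set (strip f b)" using assms by (auto simp: cyc_neq strip_def)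
  then show "amp f (strip f b) = amp f b"
    using assms(1) by (metis amp_zero_iff)
qed

lemma card_rotation_orbits:
  assumes "n \<ge> 1"
  shows "int (card (rotation_orbits n)) = 2 ^ n - 1"
proof -
  let ?B = "{b. length b = n \<and> set b \<subseteq> {cyc QK, QE} \<and> cyc QK \<in> set b}"
  have f: "QK \<noteq> QE" by simp
  have "inj_on (tri QK) ?B"
    by (rule inj_on_subset[OF inj_on_tri[OF f, of n]]) (use orbit_base_words[OF f assms] in blast)
  then have "card (rotation_orbits n) = card ?B"
    unfolding rotation_orbits_eq[OF f assms] by (rule card_image)
  also have "?B = {b. set b \<subseteq> {QI, QE} \<and> length b = n} - {replicate n QE}"
  proof -
    have "b = replicate n QE" if "length b = n" "set b \<subseteq> {QI, QE}" "QI \<notin> set b" for b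
      using that by (intro replicate_eqI) auto
    moreover have "QI \<notin> set (replicate n QE)" by simp
    moreover have "set (replicate n QE) \<subseteq> {QI, QE}" "length (replicate n QE) = n" by auto
    ultimately show ?thesis unfolding cyc.simps by blast
  qed
  also have "card \<dots> = 2 ^ n - 1"
    using card_lists_length_eq[of "{QI, QE}" n]
    by (subst card_Diff_subset) (auto simp: set_replicate_conv_if numeral_2_eq_2)
  finally show ?thesis by (simp add: of_nat_diff)
qed

lemma rotation_orbits_subset:
  assumes "d > 0" "f \<noteq> QE" "n \<ge> 1"
  shows "rotation_orbits n \<subseteq> axis_triangles d n (mirror f) \<inter> local_class n \<inter> product_centered d n"
proof
  fix T assume "T \<in> rotation_orbits n"
  then obtain b where T: "T = tri f b" and
    b: "b \<in> {b. length b = n \<and> set b \<subseteq> {cyc f, QE} \<and> cyc f \<in> set b}"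
    unfolding rotation_orbits_eq[OF assms(2,3)] by blast
  note B = orbit_base_words[OF assms(2,3) b]
  show "T \<in> axis_triangles d n (mirror f) \<inter> local_class n \<inter> product_centered d n"
    using B tri_local_iff[OF assms(2) B(1)] tri_product_centered_iff[OF assms(1,2) B(1) assms(3) B(2)]
    by (auto simp: T axis_triangles_eq[OF assms])
qed

text \<open>
  Let \<open>a\<close> be the apex for the first axis. The second reflection replaces the letter \<open>f\<close> of \<open>a\<close> by
  \<open>cyc (cyc f)\<close>. If \<open>f\<close> occurs in \<open>a\<close>, this is a new vertex, its mirror image is the third one, and
  the triangle is the orbit of \<open>a\<close>. Otherwise \<open>a\<close> is the central word, which both reflections fix,
  and then the second reflection must either fix the base word or exchange the two base vertices as the
  first one does; both are impossible. Adjacent digits \<open>f\<close>, \<open>cyc f\<close> suffice because any two digits are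
  adjacent in the cycle.
\<close>

lemma two_axes_imp_rotation_orbit:
  assumes "d > 0" "f \<noteq> QE" "n \<ge> 1"
    and "T \<in> axis_triangles d n (mirror f)" "T \<in> axis_triangles d n (mirror (cyc f))"
  shows "T \<in> rotation_orbits n"
proof -
  let ?t = "map (mirror f)" and ?u = "map (mirror (cyc f))"
  obtain b where T: "T = {apex f b, b, ?t b}" and b: "b \<in> base_words f n"
    using assms(4) unfolding axis_triangles_eq[OF assms(1-3)] by (auto simp: tri_def)
  have b': "length b = n" "hd b \<noteq> cyc (cyc f)" "\<not> set b \<subseteq> {f, QE}"
    using b by (auto simp: base_words_def)
  have inv: "?u x \<in> T" if "x \<in> T" for x
    using assms(5) that by (auto simp: axis_triangles_def)
  define a where "a = apex f b"
  have a: "set a \<subseteq> {f, QE}" "length a = n" by (simp_all add: a_def set_apex b')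
  have cf: "cyc f \<noteq> QE" using assms(2) by simp
  have m: "mirror (cyc f) f = cyc (cyc f)" "mirror (cyc f) (cyc (cyc f)) = f"
    "mirror (cyc f) QE = QE" "mirror (cyc f) (cyc f) = cyc f"
    using mirror_simps[OF cf] by simp_all
  have ua: "?u a = map cyc (map cyc a)" "?t (?u a) = map cyc a"
    using a(1) assms(2) by (auto simp: m mirror_simps simp: map_eq_conv)
  show ?thesis
  proof (cases "f \<in> set a")
    case True
    then have "?u a \<noteq> a"
      using map_mirror_fixed_iff[OF cf, of a] assms(2) by (auto simp: cyc_neq)
    moreover have "?u a \<in> T" using inv by (auto simp: T a_def)
    ultimately have "?u a = b \<or> ?u a = ?t b" by (auto simp: T a_def)
    then have "T = {a, ?u a, ?t (?u a)}"
      unfolding T a_def[symmetric]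
    proof
      assume e: "?u a = ?t b"
      show "{a, b, ?t b} = {a, ?u a, ?t (?u a)}"
        unfolding e map_mirror_mirror by blast
    qed simp
    then have "T = {a, map cyc a, map cyc (map cyc a)}"
      unfolding ua(2) unfolding ua(1) by blast
    then show ?thesis
      unfolding rotation_orbits_def using a True assms(2) by blast
  next
    case False
    then have aE: "set a \<subseteq> {QE}" using a by auto
    have inj: "?u x = ?u y \<Longrightarrow> x = y" for x y using map_mirror_mirror[of "cyc f"] by metis
    have "b \<noteq> a" using aE b' by auto
    moreover have "?u a = a" using aE m by (intro map_idI) auto
    ultimately have "?u b \<noteq> a" using inj[of b a] by auto
    moreover have "?u b \<in> T" by (rule inv) (simp add: T)
    ultimately consider "?u b = b" | "?u b = ?t b" by (auto simp: T a_def)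
    then show ?thesis
    proof cases
      case 1
      \<comment> \<open>A base word over \<open>cyc f\<close> and \<open>QE\<close> has its collapse as apex, which is not the central word.\<close>
      then have bset: "set b \<subseteq> {cyc f, QE}" using map_mirror_fixed_iff[OF cf] by blast
      then have "cyc (cyc f) \<notin> set b" using assms(2) by (auto simp: cyc_neq)
      then have "a = collapse f b"
        unfolding a_def using apex_eq_collapse_iff[OF assms(2) b'(2)] by simp
      moreover obtain x where "x \<in> set b" "x \<noteq> QE" using b'(3) by auto
      ultimately have "f \<in> set a" by (auto simp: collapse_def image_iff)
      then show ?thesis using False by blast
    next
      case 2
      have "x = QE" if "x \<in> set b" for x
      proof -
        have "mirror (cyc f) x = mirror f x" using 2 that by auto
        then show ?thesis using assms(2)
          by (cases x rule: digit_cases[OF assms(2)]) (auto simp: m mirror_simps cyc_neq)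
      qed
      then show ?thesis using b'(3) by auto
    qed
  qed
qed

lemma card_three_sets_common_intersection:
  assumes "finite A" "finite B" "finite C" "A \<inter> B = R" "B \<inter> C = R" "C \<inter> A = R"
  shows "int (card (A \<union> B \<union> C)) = int (card A) + int (card B) + int (card C) - 2 * int (card R)"
proof -
  have "(A \<union> B) \<inter> C = R" using assms(4-6) by blast
  then show ?thesis
    using card_Un_Int[OF assms(1,2)] card_Un_Int[of "A \<union> B" C] assms by simp
qed

section \<open>The counts\<close>

theorem theorem7p7:
  fixes d :: real and n :: nat
  assumes "d > 0" and "n \<ge> 1"
  shows
    "(\<forall>\<tau>\<in>digit_transpositions.
        int (card (axis_triangles d n \<tau>)) = 3 * 4 ^ (n - 1) - 2 ^ n \<and>
        int (card (axis_triangles d n \<tau> \<inter> local_class n)) = 3 ^ n - 2 ^ n \<and>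
        int (card (axis_triangles d n \<tau> \<inter> nonlocal_class d n)) = 3 * 4 ^ (n - 1) - 3 ^ n \<and>
        int (card (axis_triangles d n \<tau> \<inter> local_class n \<inter> product_centered d n))
          = int (fib (2 * n + 2)) - 2 ^ n) \<and>
     int (card (all_axis_triangles d n)) = 9 * 4 ^ (n - 1) - 5 * 2 ^ n + 2 \<and>
     int (card (all_axis_triangles d n \<inter> local_class n)) = 3 ^ (n + 1) - 5 * 2 ^ n + 2 \<and>
     int (card (all_axis_triangles d n \<inter> nonlocal_class d n)) = 9 * 4 ^ (n - 1) - 3 ^ (n + 1) \<and>
     int (card (all_axis_triangles d n \<inter> local_class n \<inter> product_centered d n))
       = 3 * int (fib (2 * n + 2)) - 5 * 2 ^ n + 2"
proof -
  let ?A = "\<lambda>f. axis_triangles d n (mirror f)" and ?L = "local_class n" and ?P = "product_centered d n"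
  have fin: "finite (?A f)" if "f \<noteq> QE" for f
    by (simp add: axis_triangles_eq[OF assms(1) that assms(2)] finite_base_words)
  have cA: "int (card (?A f)) = 3 * 4 ^ (n - 1) - 2 ^ n" if "f \<noteq> QE" for f
    unfolding axis_triangles_eq[OF assms(1) that assms(2)] card_image[OF inj_on_tri[OF that]]
    by (rule card_base_words[OF that assms(2)])
  have cL: "int (card (?A f \<inter> ?L)) = 3 ^ n - 2 ^ n" if "f \<noteq> QE" for f
  proof -
    have "?A f \<inter> ?L = tri f ` {b \<in> base_words f n. cyc (cyc f) \<notin> set b}"
      unfolding axis_triangles_eq[OF assms(1) that assms(2)] using tri_local_iff[OF that] by blast
    then show ?thesis
      using card_local_base_words[OF that assms(2)]
        card_image[OF inj_on_subset[OF inj_on_tri[OF that, of n]]] by simp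
  qed
  have cP: "int (card (?A f \<inter> ?L \<inter> ?P)) = int (fib (2 * n + 2)) - 2 ^ n" if "f \<noteq> QE" for f
  proof -
    have "?A f \<inter> ?L \<inter> ?P =
        tri f ` {b \<in> base_words f n. cyc (cyc f) \<notin> set b \<and> amp f (strip f b) = amp f b}"
      unfolding axis_triangles_eq[OF assms(1) that assms(2)]
      using tri_local_iff[OF that] tri_product_centered_iff[OF assms(1) that _ assms(2)] by blast
    then show ?thesis
      using card_centered_base_words[OF that assms(2)]
        card_image[OF inj_on_subset[OF inj_on_tri[OF that, of n]]] by simp
  qed
  have X: "W \<inter> nonlocal_class d n = W - W \<inter> ?L" if "W \<subseteq> equi_triangles d n" for W
    using that by (auto simp: nonlocal_class_def)
  have cX: "int (card (W \<inter> nonlocal_class d n)) = int (card W) - int (card (W \<inter> ?L))"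
    if "W \<subseteq> equi_triangles d n" "finite W" for W
    using that by (simp add: X card_Diff_subset card_mono of_nat_diff)
  have sub: "?A f \<subseteq> equi_triangles d n" for f by (auto simp: axis_triangles_def)
  have all: "all_axis_triangles d n = ?A QI \<union> ?A QJ \<union> ?A QK"
    by (auto simp: all_axis_triangles_def digit_transpositions_eq)
  have int: "?A f \<inter> ?A (cyc f) = rotation_orbits n" if "f \<noteq> QE" for f
    using rotation_orbits_subset[OF assms(1) that assms(2)]
      rotation_orbits_subset[OF assms(1) _ assms(2), of "cyc f"] that
      two_axes_imp_rotation_orbit[OF assms(1) that assms(2)] by auto
  \<comment> \<open>Every two of the three sets meet in the \<open>2 ^ n - 1\<close> rotation orbits.\<close>
  have union: "int (card (all_axis_triangles d n \<inter> W)) = int (card (?A QI \<inter> W)) + int (card (?A QJ \<inter> W))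
      + int (card (?A QK \<inter> W)) - 2 * (2 ^ n - 1)" if "rotation_orbits n \<subseteq> W" for W
    unfolding all Int_Un_distrib2 card_rotation_orbits[OF assms(2), symmetric]
    by (rule card_three_sets_common_intersection)
      (use int[of QI] int[of QJ] int[of QK] that fin in auto)
  have R: "rotation_orbits n \<subseteq> ?L \<inter> ?P"
    using rotation_orbits_subset[OF assms(1) _ assms(2), of QI] by auto
  have uA: "int (card (all_axis_triangles d n)) = 9 * 4 ^ (n - 1) - 5 * 2 ^ n + 2"
    using union[of UNIV] by (simp add: cA)
  have uL: "int (card (all_axis_triangles d n \<inter> ?L)) = 3 ^ (n + 1) - 5 * 2 ^ n + 2"
    using union[of ?L] R by (simp add: cL)
  have uP: "int (card (all_axis_triangles d n \<inter> ?L \<inter> ?P)) = 3 * int (fib (2 * n + 2)) - 5 * 2 ^ n + 2"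
    using union[of "?L \<inter> ?P"] R cP by (simp add: Int_assoc)
  have "int (card (all_axis_triangles d n \<inter> nonlocal_class d n)) = 9 * 4 ^ (n - 1) - 3 ^ (n + 1)"
    using cX[of "all_axis_triangles d n"] uA uL sub fin by (simp add: all)
  moreover have "\<forall>\<tau>\<in>digit_transpositions.
        int (card (axis_triangles d n \<tau>)) = 3 * 4 ^ (n - 1) - 2 ^ n \<and>
        int (card (axis_triangles d n \<tau> \<inter> local_class n)) = 3 ^ n - 2 ^ n \<and>
        int (card (axis_triangles d n \<tau> \<inter> nonlocal_class d n)) = 3 * 4 ^ (n - 1) - 3 ^ n \<and>
        int (card (axis_triangles d n \<tau> \<inter> local_class n \<inter> product_centered d n))
          = int (fib (2 * n + 2)) - 2 ^ n"
    using cA cL cP cX[OF sub fin] by (auto simp: digit_transpositions_eq)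
  ultimately show ?thesis
    using uA uL uP by blast
qed

end
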